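(* Let $p$ be a prime, $m\in\mathbb{N}$, $s\ge 2$, and let $(\gamma_j)_{j\ge1}$ be a non-increasing sequence of positive reals with $\gamma_j\le 1$. Let $(w_j)_{j\ge1}$ be a non-decreasing sequence of nonnegative integers with $w_1=0$. Let $(g_1,\dots,g_s)\in\mathcal{G}_{p,m-w_1}(x^m)\times\cdots\times\mathcal{G}_{p,m-w_s}(x^m)$ be constructed by the reduced CBC algorithm (described in the context) with modulus $f=x^m$. Then for every $d\in\{1,\dots,s\}$, $$R^d_{\boldsymbol\gamma}\big((x^{w_1}g_1,\dots,x^{w_d}g_d),x^m\big)\le \frac{1}{p^m}\prod_{i=1}^d\Big(1+\gamma_i+\gamma_i\,2p^{\min\{w_i,m\}}\,m\,\frac{p^2-1}{3p}\Big).$$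
   Context: $\mathbb{F}_p=\{0,\dots,p-1\}$ with arithmetic mod $p$; $\mathbb{F}_p[x]$ the polynomial ring. For $k\ge1$, $G_{p,k}$ is the set of polynomials over $\mathbb{F}_p$ of degree $<k$ (including $0$), and for $f\in\mathbb{F}_p[x]$, $G_{p,k}(f)=\{g\in G_{p,k}:\gcd(g,f)=1\}$. For $w\in\mathbb{N}_0$ set $\mathcal{G}_{p,m-w}(f)=G_{p,m-w}(f)$ if $w<m$ and $\mathcal{G}_{p,m-w}(f)=\{1\}$ if $w\ge m$. For $h=h_0+h_1x+\dots+h_ax^a\in\mathbb{F}_p[x]$ with $h_a\ne0$ put $r_p(h)=\frac{1}{p^{a+1}\sin^2(\pi h_a/p)}$, and for $\gamma\in\mathbb{R}$ put $r_p(0,\gamma)=1+\gamma$, $r_p(h,\gamma)=\gamma r_p(h)$ for $h\ne0$. For $f\in\mathbb{F}_p[x]$ with $\deg f=m$, $d\ge1$ and $\mathbf{g}=(g_1,\dots,g_d)\in G_{p,m}^d$, define $$R^d_{\boldsymbol\gamma}(\mathbf g,f)=\sum_{\substack{\mathbf h\in G_{p,m}^d\setminus\{\mathbf 0\}\\ h_1g_1+\dots+h_dg_d\equiv0 \bmod f}}\prod_{i=1}^d r_p(h_i,\gamma_i).$$ Reduced CBC algorithm (given $p,m,f$, weights $(\gamma_j)$, and $(w_j)$): set $g_1=1$; for $d=1,\dots,s-1$, with $g_1,\dots,g_d$ already chosen ($g_i\in\mathcal{G}_{p,m-w_i}(f)$), choose $g_{d+1}\in\mathcal{G}_{p,m-w_{d+1}}(f)$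 minimizing $R^{d+1}_{\boldsymbol\gamma}\big((x^{w_1}g_1,\dots,x^{w_d}g_d,x^{w_{d+1}}g_{d+1}),f\big)$ as a function of $g_{d+1}$. *)

theory Defs
  imports
    "HOL-Analysis.Analysis"
    "HOL-Number_Theory.Cong"
    "Berlekamp_Zassenhaus.Finite_Field"
begin

text \<open>
  The prime field with \<open>p\<close> elements is the type \<open>'p mod_ring\<close>, where \<open>'p :: prime_card\<close> and
  \<open>p = CARD('p)\<close>; its polynomial ring is \<open>'p mod_ring poly\<close>.  All finite and infinite sequences
  (of weights, exponents and polynomials) are functions on \<open>nat\<close> that are only looked at for
  indices \<open>\<ge> 1\<close>.
\<close>

text \<open>The case \<open>g = 0\<close> is separate because the library sets \<open>degree 0 = 0\<close>.\<close>

definition G :: "nat \<Rightarrow> 'p::prime_card mod_ring poly set" where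
  "G k = {g. g = 0 \<or> degree g < k}"

definition G_coprime :: "nat \<Rightarrow> 'p::prime_card mod_ring poly \<Rightarrow> 'p mod_ring poly set" where
  "G_coprime k f = {g \<in> G k. gcd g f = 1}"

text \<open>
  The search set with index \<open>m - w\<close>.  The arguments \<open>m\<close> and \<open>w\<close> are kept apart since the difference
  may be negative.
\<close>

definition G_red :: "nat \<Rightarrow> nat \<Rightarrow> 'p::prime_card mod_ring poly \<Rightarrow> 'p mod_ring poly set" where
  "G_red m w f = (if w < m then G_coprime (m - w) f else {1})"

text \<open>
  The leading coefficient enters the sine through its representative in \<open>{0, \<dots>, p - 1}\<close>.
\<close>

definition r :: "'p::prime_card mod_ring poly \<Rightarrow> real" where
  "r h = 1 / (real CARD('p) ^ (degree h + 1)
            * (sin (pi * of_int (to_int_mod_ring (lead_coeff h)) / real CARD('p)))\<^sup>2)"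

definition r_weighted :: "'p::prime_card mod_ring poly \<Rightarrow> real \<Rightarrow> real" where
  "r_weighted h c = (if h = 0 then 1 + c else c * r h)"

text \<open>
  \<open>R \<gamma> d g f\<close> with \<open>m = degree f\<close>.  A vector \<open>h \<in> G\<^sub>p\<^sub>,\<^sub>m\<^sup>d\<close> is an extensional function on \<open>{1..d}\<close>.
  The components of \<open>g\<close> are not required to have degree less than \<open>m\<close>, because the definition is
  also used for \<open>x\<^sup>w g\<close> with \<open>w \<ge> m\<close>.
\<close>

definition R :: "(nat \<Rightarrow> real) \<Rightarrow> nat \<Rightarrow> (nat \<Rightarrow> 'p::prime_card mod_ring poly)
    \<Rightarrow> 'p mod_ring poly \<Rightarrow> real" where
  "R \<gamma> d g f =
    (\<Sum>h \<in> {h \<in> ({1..d} \<rightarrow>\<^sub>E G (degree f)) - {\<lambda>i\<in>{1..d}. 0}.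
              [(\<Sum>i=1..d. h i * g i) = 0] (mod f)}.
       \<Prod>i=1..d. r_weighted (h i) (\<gamma> i))"

definition shifted :: "(nat \<Rightarrow> nat) \<Rightarrow> (nat \<Rightarrow> 'p::prime_card mod_ring poly)
    \<Rightarrow> nat \<Rightarrow> 'p mod_ring poly" where
  "shifted w g = (\<lambda>i. Polynomial.monom 1 (w i) * g i)"

text \<open>
  \<open>g 1, \<dots>, g s\<close> is a possible output of the reduced CBC algorithm; ties between minimizers may be
  broken arbitrarily.
\<close>

definition reduced_cbc :: "nat \<Rightarrow> 'p::prime_card mod_ring poly \<Rightarrow> (nat \<Rightarrow> real) \<Rightarrow> (nat \<Rightarrow> nat)
    \<Rightarrow> nat \<Rightarrow> (nat \<Rightarrow> 'p mod_ring poly) \<Rightarrow> bool" where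
  "reduced_cbc m f \<gamma> w s g \<longleftrightarrow>
    g 1 = 1 \<and>
    (\<forall>d\<in>{1..<s}.
       is_arg_min (\<lambda>q. R \<gamma> (d + 1) (shifted w (g(d + 1 := q))) f)
                  (\<lambda>q. q \<in> G_red m (w (d + 1)) f)
                  (g (d + 1)))"

end

theory Submission
  imports Defs
begin

text \<open>
  Induction on the dimension. Separating the last component \<open>k\<close> of \<open>h\<close> gives
  \<open>R\<^sup>d\<^sup>+\<^sup>1 = (1 + \<gamma>\<^sub>d\<^sub>+\<^sub>1) R\<^sup>d + \<theta>(g\<^sub>d\<^sub>+\<^sub>1)\<close>, where \<open>\<theta>\<close> collects the terms with \<open>k \<noteq> 0\<close>. The minimum of
  \<open>\<theta>\<close> over the search set is at most its average. For any fixed first components of \<open>h\<close>, averaging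
  over \<open>g\<^sub>d\<^sub>+\<^sub>1\<close> bounds the sum of \<open>r k\<close> over the admissible \<open>k\<close> by \<open>2 p\<^sup>w\<^sup>-\<^sup>m\<close> times the sum of \<open>r k\<close> over all
  \<open>k \<noteq> 0\<close>; that total is \<open>m (p\<^sup>2 - 1) / (3 p)\<close> by the classical evaluation of
  \<open>\<Sum> 1 / sin\<^sup>2 (\<pi> c / p)\<close>.
\<close>

section \<open>Parseval's identity at the roots of unity and the sum of inverse squared
  sines\<close>

lemma linear_weighted_geometric_sum:
  fixes z :: "'a::comm_ring_1"
  shows "(z - 1) * (\<Sum>j<n. of_nat j * z ^ j) = of_nat n * z ^ n - z * (\<Sum>j<n. z ^ j)"
  by (induction n) (simp_all add: algebra_simps)

text \<open>The chord length on the unit circle. The half angle turns the roots of unity at 2 pi k /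
  n into the sines at pi k / n that occur in \<open>r\<close>.\<close>

lemma cmod_cis_minus_one: "(cmod (cis \<theta> - 1))\<^sup>2 = 4 * (sin (\<theta> / 2))\<^sup>2"
proof -
  have "(cmod (cis \<theta> - 1))\<^sup>2 = (cos \<theta> - 1)\<^sup>2 + (sin \<theta>)\<^sup>2"
    by (simp add: cmod_power2)
  also have "\<dots> = ((sin \<theta>)\<^sup>2 + (cos \<theta>)\<^sup>2) + 1 - 2 * cos \<theta>"
    by (simp add: power2_eq_square algebra_simps)
  also have "\<dots> = 2 - 2 * cos (2 * (\<theta> / 2))"
    by simp
  also have "\<dots> = 4 * (sin (\<theta> / 2))\<^sup>2"
    unfolding cos_double_sin by simp
  finally show ?thesis .
qed

lemma geometric_sum_root_unity:
  fixes z :: "'a::{comm_ring,division_ring}"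
  assumes "z ^ n = 1" "z \<noteq> 1"
  shows "(\<Sum>j<n. z ^ j) = 0"
  using assms by (simp add: sum_gp_strict)

lemma sum_squares_real: "(\<Sum>j<n. (real j)\<^sup>2) = (real n - 1) * real n * (2 * real n - 1) / 6"
  by (induction n) (simp_all add: field_simps power2_eq_square)

lemma sum_linear_real: "(\<Sum>j<n. real j) = real n * (real n - 1) / 2"
  by (induction n) (simp_all add: field_simps)

lemma parseval_roots_unity:
  fixes f :: "nat \<Rightarrow> real"
  assumes n: "n > 0"
  defines "\<omega> \<equiv> \<lambda>k. cis (2 * pi * real k / real n)"
  shows "(\<Sum>k<n. (cmod (\<Sum>j<n. of_real (f j) * \<omega> k ^ j))\<^sup>2) = n * (\<Sum>j<n. (f j)\<^sup>2)"
proof -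
  \<comment> \<open>The kernel is symmetric in k and j. After the exchange k is the exponent, so the
    sums over k below become geometric.\<close>
  have pow: "\<omega> k ^ j = \<omega> j ^ k" for k j
    by (simp add: \<omega>_def Complex.DeMoivre mult_ac)
  have pow_cnj: "\<omega> k ^ i * cnj (\<omega> k ^ j) = (\<omega> i * cnj (\<omega> j)) ^ k" for i j k
    by (simp only: pow[of k] power_mult_distrib complex_cnj_power)
  have root: "\<omega> k ^ n = 1" for k
    using n by (simp add: \<omega>_def Complex.DeMoivre cis_multiple_2pi)
  have inj: "inj_on \<omega> {..<n}"
    using Complex.bij_betw_roots_unity[OF n] by (simp add: \<omega>_def bij_betw_def)
  have unit: "\<omega> j * cnj (\<omega> j) = 1" for j
    by (simp add: \<omega>_def cis_cnj cis_mult)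
  have orth: "(\<Sum>k<n. (\<omega> i * cnj (\<omega> j)) ^ k) = (if i = j then of_nat n else 0)"
    if "i < n" "j < n" for i j
  proof (cases "i = j")
    case False
    have "\<omega> i * cnj (\<omega> j) \<noteq> 1"
    proof
      assume "\<omega> i * cnj (\<omega> j) = 1"
      then have "\<omega> i * (\<omega> j * cnj (\<omega> j)) = \<omega> j"
        by (simp add: algebra_simps)
      then show False
        using inj that False by (auto simp: unit inj_on_def)
    qed
    moreover have "(\<omega> i * cnj (\<omega> j)) ^ n = 1"
      by (simp add: power_mult_distrib root flip: complex_cnj_power)
    ultimately show ?thesis
      using False geometric_sum_root_unity by auto
  qed (simp add: unit)
  have "complex_of_real (\<Sum>k<n. (cmod (\<Sum>j<n. of_real (f j) * \<omega> k ^ j))\<^sup>2)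
      = (\<Sum>k<n. (\<Sum>i<n. of_real (f i) * \<omega> k ^ i) * cnj (\<Sum>j<n. of_real (f j) * \<omega> k ^ j))"
    by (simp add: complex_norm_square del: of_real_power cnj_sum)
  also have "\<dots> = (\<Sum>k<n. \<Sum>i<n. \<Sum>j<n. of_real (f i) * of_real (f j) * (\<omega> k ^ i * cnj (\<omega> k ^ j)))"
    by (simp add: sum_product mult_ac)
  also have "\<dots> = (\<Sum>k<n. \<Sum>i<n. \<Sum>j<n. of_real (f i) * of_real (f j) * (\<omega> i * cnj (\<omega> j)) ^ k)"
    by (simp only: pow_cnj)
  also have "\<dots> = (\<Sum>i<n. \<Sum>k<n. \<Sum>j<n. of_real (f i) * of_real (f j) * (\<omega> i * cnj (\<omega> j)) ^ k)"
    by (rule sum.swap)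
  also have "\<dots> = (\<Sum>i<n. \<Sum>j<n. \<Sum>k<n. of_real (f i) * of_real (f j) * (\<omega> i * cnj (\<omega> j)) ^ k)"
    by (intro sum.cong sum.swap refl)
  also have "\<dots> = (\<Sum>i<n. \<Sum>j<n. of_real (f i) * of_real (f j) * (\<Sum>k<n. (\<omega> i * cnj (\<omega> j)) ^ k))"
    by (simp add: sum_distrib_left)
  also have "\<dots> = (\<Sum>i<n. \<Sum>j<n. of_real (f i) * of_real (f j) * (if i = j then of_nat n else 0))"
    using orth by (intro sum.cong refl) auto
  also have "\<dots> = of_real (n * (\<Sum>j<n. (f j)\<^sup>2))"
    by (simp add: power2_eq_square sum_distrib_left mult_ac if_distrib cong: if_cong)
  finally show ?thesis
    unfolding of_real_eq_iff .
qed

text \<open>Parseval for \<open>j \<mapsto> j\<close>, whose transform at \<open>z \<noteq> 1\<close> is \<open>n / (z - 1)\<close>.\<close>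

lemma sum_inverse_sin_squared:
  assumes n: "n > 0"
  shows "(\<Sum>k\<in>{1..<n}. 1 / (sin (pi * real k / real n))\<^sup>2) = ((real n)\<^sup>2 - 1) / 3"
proof -
  define \<omega> where "\<omega> = (\<lambda>k. cis (2 * pi * real k / real n))"
  define S where "S = (\<Sum>k\<in>{1..<n}. 1 / (sin (pi * real k / real n))\<^sup>2)"
  have root: "\<omega> k ^ n = 1" for k
    using n by (simp add: \<omega>_def Complex.DeMoivre cis_multiple_2pi)
  have "inj_on \<omega> {..<n}"
    using Complex.bij_betw_roots_unity[OF n] by (simp add: \<omega>_def bij_betw_def)
  moreover have "\<omega> 0 = 1"
    by (simp add: \<omega>_def)
  ultimately have ne: "\<omega> k \<noteq> 1" if "k \<in> {1..<n}" for k
    using that n inj_onD[of \<omega> "{..<n}" k 0] by auto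
  have transform: "(cmod (\<Sum>j<n. of_nat j * \<omega> k ^ j))\<^sup>2
      = (real n)\<^sup>2 / 4 * (1 / (sin (pi * real k / real n))\<^sup>2)" if k: "k \<in> {1..<n}" for k
  proof -
    \<comment> \<open>On the right of the linear weighted sum, \<omega> k ^ n = 1 and the geometric
      sum vanishes, so only n is left.\<close>
    have "(\<omega> k - 1) * (\<Sum>j<n. of_nat j * \<omega> k ^ j) = of_nat n"
      using linear_weighted_geometric_sum[of "\<omega> k" n] geometric_sum_root_unity[OF root ne[OF k]]
      by (simp add: root)
    then have "(cmod (\<omega> k - 1))\<^sup>2 * (cmod (\<Sum>j<n. of_nat j * \<omega> k ^ j))\<^sup>2 = (real n)\<^sup>2"
      by (metis norm_mult norm_of_nat power_mult_distrib)
    moreover have "(cmod (\<omega> k - 1))\<^sup>2 = 4 * (sin (pi * real k / real n))\<^sup>2"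
      by (simp add: \<omega>_def cmod_cis_minus_one)
    moreover have "(cmod (\<omega> k - 1))\<^sup>2 \<noteq> 0"
      using ne[OF k] by simp
    ultimately show ?thesis
      by (simp only:) (simp add: field_simps)
  qed
  have "real n * (\<Sum>j<n. (real j)\<^sup>2) = (\<Sum>k<n. (cmod (\<Sum>j<n. of_nat j * \<omega> k ^ j))\<^sup>2)"
    using parseval_roots_unity[OF n, of real] by (simp add: \<omega>_def)
  \<comment> \<open>Frequency 0 is split off: there \<omega> 0 = 1, so \<open>transform\<close> does
    not apply and the transform is the plain sum of the j.\<close>
  also have "\<dots> = (\<Sum>k\<in>insert 0 {1..<n}. (cmod (\<Sum>j<n. of_nat j * \<omega> k ^ j))\<^sup>2)"
    using n by (intro sum.cong refl) auto
  also have "\<dots> = (cmod (of_real (\<Sum>j<n. real j)))\<^sup>2 + (real n)\<^sup>2 / 4 * S"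
    by (simp add: transform \<open>\<omega> 0 = 1\<close> S_def sum_distrib_left)
  finally have "real n * (\<Sum>j<n. (real j)\<^sup>2) = (\<Sum>j<n. real j)\<^sup>2 + (real n)\<^sup>2 / 4 * S"
    unfolding norm_of_real by simp
  then have "(real n)\<^sup>2 * S = 4 * (real n * (\<Sum>j<n. (real j)\<^sup>2) - (\<Sum>j<n. real j)\<^sup>2)"
    by simp
  also have "\<dots> = (real n)\<^sup>2 * (((real n)\<^sup>2 - 1) / 3)"
    unfolding sum_squares_real sum_linear_real by (simp add: field_simps power2_eq_square)
  finally have "S = ((real n)\<^sup>2 - 1) / 3"
    using n by simp
  then show ?thesis
    by (simp add: S_def)
qed


section \<open>Sums of \<open>r\<close>\<close>

lemma G_0: "G 0 = {0}"
  by (auto simp: G_def)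

lemma pCons_in_G_Suc_iff: "pCons c q \<in> G (Suc k) \<longleftrightarrow> q \<in> G k"
  by (auto simp: G_def)

lemma G_Suc: "G (Suc k) = (\<lambda>(c, q). pCons c q) ` (UNIV \<times> G k)"
proof -
  have "h \<in> (\<lambda>(c, q). pCons c q) ` (UNIV \<times> G k)" if "h \<in> G (Suc k)" for h
    using that by (cases h) (auto simp: pCons_in_G_Suc_iff)
  then show ?thesis
    by (auto simp: pCons_in_G_Suc_iff)
qed

lemma inj_on_pCons: "inj_on (\<lambda>(c, q). pCons c q) A"
  by (auto simp: inj_on_def)

lemma finite_G [simp]: "finite (G k)"
  by (induction k) (simp_all add: G_0 G_Suc)

lemma card_G: "card (G k :: 'p::prime_card mod_ring poly set) = CARD('p) ^ k"
  by (induction k) (simp_all add: G_0 G_Suc card_image inj_on_pCons card_cartesian_product)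

lemma card_prime_card_gt_1: "CARD('p::prime_card) > 1"
  using prime_card[where 'a = 'p] prime_gt_1_nat by blast

lemma r_nonneg: "r h \<ge> 0"
  by (simp add: r_def)

lemma r_pCons:
  fixes q :: "'p::prime_card mod_ring poly"
  assumes "q \<noteq> 0"
  shows "r (pCons c q) = r q / real CARD('p)"
  using assms by (simp add: r_def mult_ac)

lemma r_monom_mult:
  fixes q :: "'p::prime_card mod_ring poly"
  assumes "q \<noteq> 0"
  shows "r (Polynomial.monom 1 t * q) = r q / real CARD('p) ^ t"
proof -
  have "degree (Polynomial.monom 1 t * q) = t + degree q"
    using assms by (simp add: degree_mult_eq degree_monom_eq monom_eq_0_iff)
  moreover have "lead_coeff (Polynomial.monom 1 t * q) = lead_coeff q"
    by (simp only: lead_coeff_mult lead_coeff_monom mult_1_left)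
  ultimately show ?thesis
    by (simp only: r_def) (simp add: power_add mult_ac)
qed

lemma sum_r_constants:
  "(\<Sum>c\<in>UNIV - {0 :: 'p::prime_card mod_ring}. r [:c:]) = (real CARD('p) ^ 2 - 1) / (3 * real CARD('p))"
proof -
  let ?p = "CARD('p)"
  have p: "?p > 0"
    by simp
  \<comment> \<open>Passing to representatives turns the nonzero residues into the indices 1, ..., p
    - 1 of the sine sum.\<close>
  have bij: "bij_betw (\<lambda>c. nat (to_int_mod_ring c)) (UNIV - {0 :: 'p mod_ring}) {1..<?p}"
  proof (rule bij_betwI[where g = of_nat])
    show "(\<lambda>c. nat (to_int_mod_ring c)) \<in> UNIV - {0 :: 'p mod_ring} \<rightarrow> {1..<?p}"
    proof
      fix c :: "'p mod_ring" assume c: "c \<in> UNIV - {0}"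
      have "to_int_mod_ring c \<in> {0..<int ?p}"
        using range_to_int_mod_ring[where 'a = 'p] by blast
      moreover have "to_int_mod_ring c \<noteq> 0"
        using c by simp
      ultimately have "1 \<le> to_int_mod_ring c" "to_int_mod_ring c < int ?p"
        unfolding atLeastLessThan_iff by linarith+
      then show "nat (to_int_mod_ring c) \<in> {1..<?p}"
        by (auto simp: nat_less_iff)
    qed
    show "of_nat \<in> {1..<?p} \<rightarrow> UNIV - {0 :: 'p mod_ring}"
      by (auto simp: of_nat_of_int_mod_ring of_int_mod_ring.rep_eq
          simp flip: to_int_mod_ring_hom.hom_0_iff)
  next
    fix c :: "'p mod_ring"
    have "to_int_mod_ring c \<in> {0..<int ?p}"
      using range_to_int_mod_ring[where 'a = 'p] by blast
    then show "of_nat (nat (to_int_mod_ring c)) = c"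
      by (simp add: of_nat_of_int_mod_ring)
  next
    fix k assume "k \<in> {1..<?p}"
    then show "nat (to_int_mod_ring (of_nat k :: 'p mod_ring)) = k"
      by (simp add: of_nat_of_int_mod_ring)
  qed
  have "(\<Sum>c\<in>UNIV - {0 :: 'p mod_ring}. r [:c:])
      = (\<Sum>c\<in>UNIV - {0 :: 'p mod_ring}. 1 / ?p * (1 / (sin (pi * real (nat (to_int_mod_ring c)) / ?p))\<^sup>2))"
  proof (rule sum.cong)
    fix c :: "'p mod_ring"
    have "to_int_mod_ring c \<in> {0..<int ?p}"
      using range_to_int_mod_ring[where 'a = 'p] by blast
    then show "r [:c:] = 1 / ?p * (1 / (sin (pi * real (nat (to_int_mod_ring c)) / ?p))\<^sup>2)"
      by (simp add: r_def)
  qed simp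
  also have "\<dots> = (\<Sum>k\<in>{1..<?p}. 1 / ?p * (1 / (sin (pi * real k / ?p))\<^sup>2))"
    by (rule sum.reindex_bij_betw[OF bij, where g = "\<lambda>k. 1 / ?p * (1 / (sin (pi * real k / ?p))\<^sup>2)"])
  also have "\<dots> = 1 / ?p * (((real ?p)\<^sup>2 - 1) / 3)"
    by (simp only: sum_inverse_sin_squared[OF p] flip: sum_distrib_left)
  finally show ?thesis
    by (simp add: mult_ac)
qed

text \<open>Every degree below k contributes the same amount: raising the degree by one gives p
  choices for the new constant coefficient, and each costs a factor 1/p in \<open>r\<close>.\<close>

lemma sum_r:
  "(\<Sum>h\<in>G k - {0 :: 'p::prime_card mod_ring poly}. r h)
    = real k * ((real CARD('p) ^ 2 - 1) / (3 * real CARD('p)))"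
proof (induction k)
  case (Suc k)
  let ?C = "(real CARD('p) ^ 2 - 1) / (3 * real CARD('p))"
  let ?A = "(\<lambda>c. [:c:]) ` (UNIV - {0 :: 'p mod_ring})"
  let ?B = "(\<lambda>(c, q). pCons c q) ` (UNIV \<times> (G k - {0 :: 'p mod_ring poly}))"
  have "0 \<in> (G k :: 'p mod_ring poly set)"
    by (simp add: G_def)
  \<comment> \<open>Nonzero constants are kept apart because \<open>r_pCons\<close> requires a
    nonzero tail.\<close>
  then have "G (Suc k) - {0 :: 'p mod_ring poly} = ?A \<union> ?B"
    unfolding G_Suc by (auto simp: image_iff)
  moreover have "?A \<inter> ?B = {}"
    by auto
  ultimately have "(\<Sum>h\<in>G (Suc k) - {0 :: 'p mod_ring poly}. r h) = sum r ?A + sum r ?B"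
    by (simp add: sum.union_disjoint)
  also have "sum r ?A = ?C"
    by (subst sum.reindex) (auto simp: inj_on_def sum_r_constants)
  also have "sum r ?B = (\<Sum>(c :: 'p mod_ring, q :: 'p mod_ring poly)\<in>UNIV \<times> (G k - {0}). r q / real CARD('p))"
    unfolding sum.reindex[OF inj_on_pCons] by (rule sum.cong) (auto intro: r_pCons)
  also have "\<dots> = (\<Sum>q\<in>G k - {0 :: 'p mod_ring poly}. r q)"
    by (simp flip: sum.cartesian_product sum_divide_distrib)
  finally show ?case
    using Suc by (simp only: of_nat_Suc distrib_right mult_1_left)
qed (simp add: G_0)

text \<open>Division by x^t maps these multiples bijectively onto the nonzero elements of
  \<open>G (m - t)\<close> and scales \<open>r\<close> uniformly. For t > m both sides are 0, by
  truncated subtraction on the right.\<close>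

lemma sum_r_multiples:
  "(\<Sum>h\<in>{h \<in> G m - {0 :: 'p::prime_card mod_ring poly}. Polynomial.monom 1 t dvd h}. r h)
    = real (m - t) * ((real CARD('p) ^ 2 - 1) / (3 * real CARD('p))) / real CARD('p) ^ t"
proof -
  let ?x = "Polynomial.monom (1 :: 'p mod_ring) t"
  have "?x \<noteq> 0"
    by (simp add: monom_eq_0_iff)
  then have "{h \<in> G m - {0}. ?x dvd h} = (\<lambda>q. ?x * q) ` (G (m - t) - {0})"
    by (fastforce simp: G_def degree_mult_eq degree_monom_eq elim!: dvdE)
  moreover have "inj_on (\<lambda>q. ?x * q) (G (m - t) - {0})"
    using \<open>?x \<noteq> 0\<close> by (auto simp: inj_on_def)
  ultimately have "(\<Sum>h\<in>{h \<in> G m - {0}. ?x dvd h}. r h)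
      = (\<Sum>q\<in>G (m - t) - {0 :: 'p mod_ring poly}. r q / real CARD('p) ^ t)"
    by (simp add: sum.reindex r_monom_mult)
  then show ?thesis
    by (simp only: sum_r flip: sum_divide_distrib)
qed

section \<open>Residues modulo powers of \<open>x\<close>\<close>

lemma coprime_monom_1:
  fixes g :: "'a::field_gcd poly"
  assumes "poly.coeff g 0 \<noteq> 0"
  shows "coprime (Polynomial.monom 1 n) g"
proof -
  have "\<not> [:0, 1:] dvd g"
    using assms monom_1_dvd_iff'[of 1 g] by (simp add: monom_altdef)
  then have "coprime [:0, 1:] g"
    by (intro prime_elem_imp_coprime prime_elem_linear_field_poly) auto
  then show ?thesis
    by (simp add: monom_altdef)
qed

lemma gcd_monom_1_eq_1_iff:
  fixes g :: "'a::field_gcd poly"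
  assumes "n > 0"
  shows "gcd g (Polynomial.monom 1 n) = 1 \<longleftrightarrow> poly.coeff g 0 \<noteq> 0"
proof
  assume gcd: "gcd g (Polynomial.monom 1 n) = 1"
  show "poly.coeff g 0 \<noteq> 0"
  proof
    assume "poly.coeff g 0 = 0"
    then have "Polynomial.monom 1 1 dvd gcd g (Polynomial.monom 1 n)"
      using assms by (auto simp: monom_1_dvd_iff')
    then have "Polynomial.monom (1::'a) 1 dvd 1"
      unfolding gcd .
    then show False
      by (simp add: poly_dvd_1 degree_monom_eq)
  qed
next
  assume "poly.coeff g 0 \<noteq> 0"
  then show "gcd g (Polynomial.monom 1 n) = 1"
    using coprime_monom_1 by (metis coprime_commute coprime_imp_gcd_eq_1)
qed

lemma monom_1_dvd_mult_iff:
  fixes g :: "'a::field_gcd poly"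
  assumes "poly.coeff g 0 \<noteq> 0"
  shows "Polynomial.monom 1 n dvd h * g \<longleftrightarrow> Polynomial.monom 1 n dvd h"
  using coprime_monom_1[OF assms] by (rule coprime_dvd_mult_left_iff)

text \<open>If t < n, then h is x^t times a polynomial with nonzero constant coefficient, which can
  be cancelled modulo powers of x. Hence the elements of \<open>A\<close> agree modulo x^(n-t), and
  only their t upper coefficients remain free. If t = n, the bound is just the size of
  \<open>G n\<close>.\<close>

lemma card_le_of_congruent:
  fixes h :: "'p::prime_card mod_ring poly"
  assumes t: "t \<le> n" "Polynomial.monom 1 t dvd h" "t < n \<Longrightarrow> \<not> Polynomial.monom 1 (Suc t) dvd h"
    and A: "A \<subseteq> G n" "\<And>g g'. g \<in> A \<Longrightarrow> g' \<in> A \<Longrightarrow> Polynomial.monom 1 n dvd (g - g') * h"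
  shows "card A \<le> CARD('p) ^ t"
proof -
  have dvd: "Polynomial.monom 1 (n - t) dvd g - g'" if g: "g \<in> A" "g' \<in> A" for g g'
  proof (cases "t = n")
    case True
    then show ?thesis
      by (simp add: monom_1_dvd_iff')
  next
    case False
    obtain q where q: "h = Polynomial.monom 1 t * q"
      using t(2) by (elim dvdE)
    have "poly.coeff q 0 \<noteq> 0"
      using t False unfolding q
      by (auto simp: monom_1_dvd_iff' coeff_monom_mult less_Suc_eq)
    have "Polynomial.monom 1 n = Polynomial.monom 1 t * (Polynomial.monom 1 (n - t) :: 'p mod_ring poly)"
      using t(1) by (simp add: mult_monom)
    then have "Polynomial.monom 1 t * Polynomial.monom 1 (n - t)
        dvd Polynomial.monom 1 t * ((g - g') * q)"
      using A(2)[OF g] by (simp add: q mult_ac)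
    then have "Polynomial.monom 1 (n - t) dvd (g - g') * q"
      by (simp add: monom_eq_0_iff)
    then show ?thesis
      using \<open>poly.coeff q 0 \<noteq> 0\<close> by (simp add: monom_1_dvd_mult_iff)
  qed
  \<comment> \<open>The shift discards exactly the lower coefficients, which are common to all of
    \<open>A\<close>.\<close>
  have "inj_on (poly_shift (n - t)) A"
  proof (rule inj_onI, rule poly_eqI)
    fix g g' i assume g: "g \<in> A" "g' \<in> A" and eq: "poly_shift (n - t) g = poly_shift (n - t) g'"
    show "poly.coeff g i = poly.coeff g' i"
    proof (cases "i < n - t")
      case True
      then show ?thesis
        using dvd[OF g] by (simp add: monom_1_dvd_iff')
    next
      case False
      then show ?thesis
        using arg_cong[OF eq, of "\<lambda>q. poly.coeff q (i - (n - t))"] by (simp add: coeff_poly_shift)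
    qed
  qed
  moreover have "poly_shift (n - t) ` A \<subseteq> G t"
  proof clarify
    fix g assume "g \<in> A"
    then have "poly.coeff g i = 0" if "i \<ge> n" for i
      using A(1) that by (auto simp: G_def coeff_eq_0)
    then have "poly.coeff (poly_shift (n - t) g) i = 0" if "i \<ge> t" for i
      using that t(1) by (simp add: coeff_poly_shift)
    then show "poly_shift (n - t) g \<in> G t"
      by (metis (mono_tags, lifting) G_def leading_coeff_0_iff mem_Collect_eq not_le)
  qed
  ultimately have "card A \<le> card (G t :: 'p mod_ring poly set)"
    by (intro card_inj_on_le) auto
  then show ?thesis
    by (simp add: card_G)
qed


section \<open>The search sets\<close>

lemma finite_G_red [simp]: "finite (G_red m w f)"
  by (simp add: G_red_def G_coprime_def)

text \<open>Coprimality to x^m only asks for a nonzero constant coefficient, which leaves (p - 1)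
  p^(n-1) polynomials. The estimate p <= 2 (p - 1) is the source of the factor 2 in the final
  bound.\<close>

lemma card_G_coprime_monom:
  assumes "n > 0" "m > 0"
  shows "CARD('p) ^ n \<le> 2 * card (G_coprime n (Polynomial.monom 1 m :: 'p::prime_card mod_ring poly))"
proof -
  obtain k where n: "n = Suc k"
    using assms(1) gr0_conv_Suc by auto
  have "(\<lambda>(c, q). pCons c q) ` ((UNIV - {0 :: 'p mod_ring}) \<times> G k)
      \<subseteq> G_coprime n (Polynomial.monom 1 m)" (is "?L \<subseteq> ?R")
    using assms(2) by (auto simp: G_coprime_def n pCons_in_G_Suc_iff gcd_monom_1_eq_1_iff)
  then have "card ?L \<le> card ?R"
    by (intro card_mono) (simp_all add: G_coprime_def)
  moreover have "card ?L = (CARD('p) - 1) * CARD('p) ^ k"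
    by (simp add: card_image inj_on_pCons card_cartesian_product card_G card_Diff_singleton)
  moreover have "CARD('p) \<le> 2 * (CARD('p) - 1)"
    using card_prime_card_gt_1[where 'p = 'p] by linarith
  then have "CARD('p) ^ n \<le> 2 * ((CARD('p) - 1) * CARD('p) ^ k)"
    unfolding n power_Suc mult.assoc[symmetric] by (rule mult_right_mono) simp
  ultimately show ?thesis
    by linarith
qed

text \<open>
  For fixed \<open>u\<close>, the order \<open>t\<close> of vanishing of \<open>h\<close> at \<open>0\<close>, cut off at \<open>m - w\<close>, is the same for all
  solutions \<open>(h, q)\<close>.  Each \<open>h\<close> occurs with at most \<open>p\<^sup>t\<close> different \<open>q\<close>, which is compensated by the
  factor \<open>p\<^sup>-\<^sup>t\<close> in the sum of \<open>r\<close> over the multiples of \<open>x\<^sup>t\<close>.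
\<close>

lemma sum_r_solutions_le:
  fixes u :: "'p::prime_card mod_ring poly"
  assumes "m > 0" "w < m"
  shows "(\<Sum>q\<in>G_coprime (m - w) (Polynomial.monom 1 m).
            \<Sum>h\<in>{h \<in> G m - {0}. Polynomial.monom 1 m dvd u + h * (Polynomial.monom 1 w * q)}. r h)
    \<le> real m * ((real CARD('p) ^ 2 - 1) / (3 * real CARD('p)))"
    (is "(\<Sum>q\<in>?A. \<Sum>h\<in>{h \<in> ?H. ?sol q h}. r h) \<le> real m * ?C")
proof (cases "\<exists>q\<in>?A. \<exists>h\<in>?H. ?sol q h")
  case False
  then have "{h \<in> ?H. ?sol q h} = {}" if "q \<in> ?A" for q
    using that by blast
  then have "(\<Sum>q\<in>?A. \<Sum>h\<in>{h \<in> ?H. ?sol q h}. r h) = 0"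
    by (simp only: sum.empty sum.neutral_const cong: sum.cong)
  moreover have "?C \<ge> 0"
    using card_prime_card_gt_1[where 'p = 'p] by simp
  ultimately show ?thesis
    by simp
next
  case True
  \<comment> \<open>Any one solution serves as the reference from which the common vanishing order
    is read off.\<close>
  then obtain q\<^sub>1 h\<^sub>1 where 1: "q\<^sub>1 \<in> ?A" "?sol q\<^sub>1 h\<^sub>1"
    by blast
  define n where "n = m - w"
  have unit: "poly.coeff q 0 \<noteq> 0" if "q \<in> ?A" for q
    using that \<open>m > 0\<close> by (simp add: G_coprime_def gcd_monom_1_eq_1_iff)
  have split: "Polynomial.monom 1 m = Polynomial.monom 1 w * (Polynomial.monom 1 n :: 'p mod_ring poly)"
    using \<open>w < m\<close> by (simp add: mult_monom n_def)
  \<comment> \<open>Subtracting two solutions eliminates u. Cancelling x^w then lowers the modulus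
    to x^n.\<close>
  have diff: "Polynomial.monom 1 n dvd h * q - h' * q'" if "?sol q h" "?sol q' h'" for q h q' h'
  proof -
    have "Polynomial.monom 1 m dvd (u + h * (Polynomial.monom 1 w * q)) - (u + h' * (Polynomial.monom 1 w * q'))"
      using that by (rule dvd_diff)
    also have "\<dots> = Polynomial.monom 1 w * (h * q - h' * q')"
      by (simp add: algebra_simps)
    finally show ?thesis
      by (simp add: split monom_eq_0_iff)
  qed
  \<comment> \<open>Candidates have nonzero constant coefficient, so multiplying by them does not
    affect divisibility by x^k. The congruence is only known modulo x^n, hence the restriction to k
    <= n.\<close>
  have same: "Polynomial.monom 1 k dvd h \<longleftrightarrow> Polynomial.monom 1 k dvd h\<^sub>1"
    if "q \<in> ?A" "?sol q h" "k \<le> n" for q h k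
  proof -
    have "Polynomial.monom 1 k dvd (Polynomial.monom 1 n :: 'p mod_ring poly)"
      using \<open>k \<le> n\<close> by (simp add: monom_1_dvd_iff')
    then have "Polynomial.monom 1 k dvd h * q - h\<^sub>1 * q\<^sub>1"
      using diff[OF that(2) 1(2)] by (rule dvd_trans)
    then have "Polynomial.monom 1 k dvd h * q \<longleftrightarrow> Polynomial.monom 1 k dvd h\<^sub>1 * q\<^sub>1"
      by (metis dvd_add_right_iff diff_add_cancel)
    then show ?thesis
      using unit[OF that(1)] unit[OF 1(1)] by (simp add: monom_1_dvd_mult_iff)
  qed
  define t where "t = (GREATEST k. k \<le> n \<and> Polynomial.monom 1 k dvd h\<^sub>1)"
  have "0 \<le> n \<and> Polynomial.monom 1 0 dvd h\<^sub>1"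
    by (simp add: monom_1_dvd_iff')
  then have t: "t \<le> n \<and> Polynomial.monom 1 t dvd h\<^sub>1"
    unfolding t_def by (rule GreatestI_nat[where b = n]) simp
  have t_max: "\<not> Polynomial.monom 1 (Suc t) dvd h\<^sub>1" if "t < n"
    using Greatest_le_nat[of "\<lambda>k. k \<le> n \<and> Polynomial.monom 1 k dvd h\<^sub>1" "Suc t" n] that
    unfolding t_def[symmetric] by (auto simp: Suc_le_eq)
  define H where "H = {h \<in> ?H. Polynomial.monom 1 t dvd h}"
  have "finite H"
    by (simp add: H_def)
  have A: "finite ?A"
    by (simp add: G_coprime_def)
  have count: "real (card {q \<in> ?A. ?sol q h}) \<le> real CARD('p) ^ t" for h
  proof (cases "\<exists>q\<in>?A. ?sol q h")
    case True
    then obtain q\<^sub>2 where "q\<^sub>2 \<in> ?A" "?sol q\<^sub>2 h"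
      by blast
    note same = same[OF this]
    have "card {q \<in> ?A. ?sol q h} \<le> CARD('p) ^ t"
    proof (rule card_le_of_congruent)
      show "t \<le> n" "Polynomial.monom 1 t dvd h"
        using t same by auto
      show "\<not> Polynomial.monom 1 (Suc t) dvd h" if "t < n"
        using t_max same[of "Suc t"] that by auto
      show "{q \<in> ?A. ?sol q h} \<subseteq> G n"
        by (auto simp: G_coprime_def n_def)
      show "Polynomial.monom 1 n dvd (q - q') * h"
        if "q \<in> {q \<in> ?A. ?sol q h}" "q' \<in> {q \<in> ?A. ?sol q h}" for q q'
        using diff[of h q h q'] that by (simp add: algebra_simps)
    qed
    then show ?thesis
      by (simp only: of_nat_le_iff flip: of_nat_power)
  next
    case False
    then have "{q \<in> ?A. ?sol q h} = {}"
      by blast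
    then show ?thesis
      by (simp only: card.empty of_nat_0) simp
  qed
  \<comment> \<open>Restricting to \<open>H\<close> before the sums are exchanged is what yields the
    factor p^(-t); bounding over all of \<open>?H\<close> would lose it.\<close>
  have "{h \<in> ?H. ?sol q h} = {h \<in> H. ?sol q h}" if "q \<in> ?A" for q
    using same[OF that _ conjunct1[OF t]] t unfolding H_def by blast
  then have "(\<Sum>q\<in>?A. \<Sum>h\<in>{h \<in> ?H. ?sol q h}. r h) = (\<Sum>q\<in>?A. \<Sum>h\<in>{h \<in> H. ?sol q h}. r h)"
    by (simp only: cong: sum.cong)
  also have "\<dots> = (\<Sum>h\<in>H. \<Sum>q\<in>{q \<in> ?A. ?sol q h}. r h)"
    using A \<open>finite H\<close> by (rule sum.swap_restrict)
  also have "\<dots> = (\<Sum>h\<in>H. real (card {q \<in> ?A. ?sol q h}) * r h)"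
    by simp
  also have "\<dots> \<le> (\<Sum>h\<in>H. real CARD('p) ^ t * r h)"
    by (intro sum_mono mult_right_mono count r_nonneg)
  also have "\<dots> = real (m - t) * ?C"
    unfolding H_def sum_distrib_left[symmetric] sum_r_multiples by simp
  also have "\<dots> \<le> real m * ?C"
    using card_prime_card_gt_1[where 'p = 'p] by (intro mult_right_mono) auto
  finally show ?thesis .
qed

text \<open>Rewrites the bound as the size of the search set times a bound for the average. For w >=
  m the set is {1} and the congruence is simply dropped, bounding the sum by the full sum of
  \<open>r\<close>.\<close>

lemma sum_r_solutions_G_red_le:
  fixes u :: "'p::prime_card mod_ring poly"
  assumes "m > 0"
  shows "(\<Sum>q\<in>G_red m w (Polynomial.monom 1 m).
            \<Sum>h\<in>{h \<in> G m - {0}. Polynomial.monom 1 m dvd u + h * (Polynomial.monom 1 w * q)}. r h)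
    \<le> real (card (G_red m w (Polynomial.monom 1 m :: 'p mod_ring poly)))
       * (2 * real CARD('p) ^ min w m * real m * ((real CARD('p) ^ 2 - 1) / (3 * real CARD('p)))
          / real CARD('p) ^ m)"
    (is "?S \<le> real (card ?A) * (2 * ?p ^ _ * real m * ?C / ?p ^ m)")
proof -
  have C: "real m * ?C \<ge> 0"
    using card_prime_card_gt_1[where 'p = 'p] by simp
  have "?S \<le> real m * ?C"
  proof (cases "w < m")
    case True
    then show ?thesis
      using sum_r_solutions_le[OF assms True, of u] by (simp add: G_red_def)
  next
    case False
    then have "?S \<le> (\<Sum>h\<in>G m - {0 :: 'p mod_ring poly}. r h)"
      by (simp add: G_red_def) (intro sum_mono2; auto simp: r_nonneg)
    then show ?thesis
      by (simp add: sum_r)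
  qed
  also have "\<dots> \<le> (real (card ?A) * 2 * ?p ^ min w m / ?p ^ m) * (real m * ?C)"
  proof -
    have "?p ^ (m - w) \<le> 2 * real (card ?A)"
    proof (cases "w < m")
      case True
      have "real (CARD('p) ^ (m - w)) \<le> real (2 * card ?A)"
        unfolding of_nat_le_iff using card_G_coprime_monom[where 'p = 'p, of "m - w" m] True assms
        by (simp add: G_red_def)
      then show ?thesis
        by simp
    qed (simp add: G_red_def)
    then have "?p ^ (m - w) * ?p ^ min w m \<le> 2 * real (card ?A) * ?p ^ min w m"
      by (rule mult_right_mono) simp
    \<comment> \<open>Truncated subtraction makes this hold for w >= m as well.\<close>
    moreover have "?p ^ (m - w) * ?p ^ min w m = ?p ^ m"
      by (simp add: min_def flip: power_add)
    ultimately have "1 \<le> real (card ?A) * 2 * ?p ^ min w m / ?p ^ m"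
      by (simp add: field_simps)
    then show ?thesis
      using C by (metis mult_right_mono mult_1)
  qed
  finally show ?thesis
    by (simp add: mult_ac)
qed

section \<open>Recursion in the dimension\<close>

lemma sum_r_weighted:
  "(\<Sum>h\<in>(G k :: 'p::prime_card mod_ring poly set). r_weighted h c)
    = 1 + c + c * (real k * ((real CARD('p) ^ 2 - 1) / (3 * real CARD('p))))"
proof -
  have "0 \<in> (G k :: 'p mod_ring poly set)"
    by (simp add: G_def)
  then have "(\<Sum>h\<in>(G k :: 'p mod_ring poly set). r_weighted h c)
      = r_weighted (0 :: 'p mod_ring poly) c + (\<Sum>h\<in>G k - {0 :: 'p mod_ring poly}. r_weighted h c)"
    by (intro sum.remove) simp
  also have "(\<Sum>h\<in>G k - {0 :: 'p mod_ring poly}. r_weighted h c)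
      = c * (\<Sum>h\<in>G k - {0 :: 'p mod_ring poly}. r h)"
    unfolding sum_distrib_left by (intro sum.cong) (auto simp: r_weighted_def)
  finally show ?thesis
    by (simp add: sum_r) (simp add: r_weighted_def)
qed

lemma r_weighted_nonneg: "c \<ge> 0 \<Longrightarrow> r_weighted h c \<ge> 0"
  by (simp add: r_weighted_def r_nonneg)

text \<open>With the zero vector included and the congruence written as an indicator, the index set
  is a full product, which can be split by components.\<close>

lemma R_eq:
  "R \<gamma> d g f = (\<Sum>h\<in>{1..d} \<rightarrow>\<^sub>E G (degree f). if f dvd (\<Sum>i=1..d. h i * g i)
      then \<Prod>i=1..d. r_weighted (h i) (\<gamma> i) else 0) - (\<Prod>i=1..d. 1 + \<gamma> i)"
proof -
  let ?z = "\<lambda>i\<in>{1..d}. 0 :: 'a mod_ring poly"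
  let ?F = "\<lambda>h. if f dvd (\<Sum>i=1..d. h i * g i) then \<Prod>i=1..d. r_weighted (h i) (\<gamma> i) else 0"
  let ?P = "{1..d} \<rightarrow>\<^sub>E G (degree f) :: (nat \<Rightarrow> 'a mod_ring poly) set"
  have fin: "finite ?P"
    by (intro finite_PiE) simp_all
  have "?z \<in> ?P"
    by (auto simp: G_def)
  then have "sum ?F ?P = ?F ?z + sum ?F (?P - {?z})"
    using fin by (intro sum.remove)
  also have "?F ?z = (\<Prod>i=1..d. 1 + \<gamma> i)"
    by (simp add: r_weighted_def)
  also have "sum ?F (?P - {?z}) = R \<gamma> d g f"
    unfolding R_def cong_0_iff using fin by (intro sum.inter_filter[symmetric]) simp
  finally show ?thesis
    by simp
qed

text \<open>Split by the last component k of the vector. In the second sum h runs over the whole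
  product, zero included, because k is already nonzero.\<close>

lemma R_Suc:
  fixes g :: "nat \<Rightarrow> 'p::prime_card mod_ring poly"
  shows "R \<gamma> (Suc d) g f = (1 + \<gamma> (Suc d)) * R \<gamma> d g f
    + \<gamma> (Suc d) * (\<Sum>h\<in>{1..d} \<rightarrow>\<^sub>E G (degree f). (\<Prod>i=1..d. r_weighted (h i) (\<gamma> i))
        * (\<Sum>k\<in>{k \<in> G (degree f) - {0}. f dvd (\<Sum>i=1..d. h i * g i) + k * g (Suc d)}. r k))"
proof -
  let ?G = "G (degree f) :: 'p mod_ring poly set"
  let ?P = "{1..d} \<rightarrow>\<^sub>E ?G"
  let ?w = "\<lambda>h. \<Prod>i=1..d. r_weighted (h i) (\<gamma> i)"
  let ?s = "\<lambda>h k. f dvd (\<Sum>i=1..d. h i * g i) + k * g (Suc d)"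
  let ?F = "\<lambda>d h. if f dvd (\<Sum>i=1..d. h i * g i) then \<Prod>i=1..d. r_weighted (h i) (\<gamma> i) else 0"
  have "0 \<in> ?G"
    by (simp add: G_def)
  have upd: "?F (Suc d) (h(Suc d := k)) = (if ?s h k then ?w h * r_weighted k (\<gamma> (Suc d)) else 0)"
    for h :: "nat \<Rightarrow> 'p mod_ring poly" and k
  proof -
    have "(\<Sum>i=1..d. (h(Suc d := k)) i * g i) = (\<Sum>i=1..d. h i * g i)"
      by (intro sum.cong) auto
    moreover have "(\<Prod>i=1..d. r_weighted ((h(Suc d := k)) i) (\<gamma> i)) = ?w h"
      by (intro prod.cong) auto
    ultimately show ?thesis
      by simp
  qed
  have inj: "inj_on (\<lambda>(k, h). h(Suc d := k)) (?G \<times> ?P)"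
    by (intro inj_combinator) simp
  have "(\<Sum>h\<in>{1..Suc d} \<rightarrow>\<^sub>E ?G. ?F (Suc d) h) = (\<Sum>h\<in>(\<lambda>(k, h). h(Suc d := k)) ` (?G \<times> ?P). ?F (Suc d) h)"
    using PiE_insert_eq[of "Suc d" "{1..d}" "\<lambda>_. ?G"] by (simp only: atLeastAtMostSuc_conv le_add1 plus_1_eq_Suc)
  also have "\<dots> = (\<Sum>(k, h)\<in>?G \<times> ?P. ?F (Suc d) (h(Suc d := k)))"
    by (subst sum.reindex[OF inj]) (simp only: o_def case_prod_unfold)
  also have "\<dots> = (\<Sum>(k, h)\<in>?G \<times> ?P. if ?s h k then ?w h * r_weighted k (\<gamma> (Suc d)) else 0)"
    by (simp only: upd)
  also have "\<dots> = (\<Sum>h\<in>?P. \<Sum>k\<in>?G. if ?s h k then ?w h * r_weighted k (\<gamma> (Suc d)) else 0)"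
    by (subst sum.swap) (simp only: sum.cartesian_product)
  also have "\<dots> = (\<Sum>h\<in>?P. (1 + \<gamma> (Suc d)) * ?F d h
      + \<gamma> (Suc d) * (?w h * (\<Sum>k\<in>{k \<in> ?G - {0}. ?s h k}. r k)))"
  proof (rule sum.cong)
    fix h
    have "(\<Sum>k\<in>?G. if ?s h k then ?w h * r_weighted k (\<gamma> (Suc d)) else 0)
        = (1 + \<gamma> (Suc d)) * ?F d h + (\<Sum>k\<in>?G - {0}. if ?s h k then ?w h * r_weighted k (\<gamma> (Suc d)) else 0)"
      using \<open>0 \<in> ?G\<close> by (subst sum.remove[of _ 0]) (simp_all add: r_weighted_def)
    also have "(\<Sum>k\<in>?G - {0}. if ?s h k then ?w h * r_weighted k (\<gamma> (Suc d)) else 0)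
        = (\<Sum>k\<in>?G - {0}. if ?s h k then \<gamma> (Suc d) * (?w h * r k) else 0)"
      by (intro sum.cong) (auto simp: r_weighted_def)
    also have "\<dots> = \<gamma> (Suc d) * (?w h * (\<Sum>k\<in>{k \<in> ?G - {0}. ?s h k}. r k))"
      unfolding sum_distrib_left by (intro sum.inter_filter[symmetric]) simp
    finally show "(\<Sum>k\<in>?G. if ?s h k then ?w h * r_weighted k (\<gamma> (Suc d)) else 0)
        = (1 + \<gamma> (Suc d)) * ?F d h + \<gamma> (Suc d) * (?w h * (\<Sum>k\<in>{k \<in> ?G - {0}. ?s h k}. r k))" .
  qed simp
  \<comment> \<open>The k = 0 part carries the factor 1 + \<gamma> (Suc d), exactly what the
    subtracted zero-vector term gains from d to d + 1; so it recombines to a multiple of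
    \<open>R \<gamma> d g f\<close>.\<close>
  finally show ?thesis
    unfolding R_eq by (simp add: sum.distrib sum_distrib_left algebra_simps)
qed

lemma R_cong: "(\<And>i. i \<in> {1..d} \<Longrightarrow> g i = g' i) \<Longrightarrow> R \<gamma> d g f = R \<gamma> d g' f"
  unfolding R_eq by (intro arg_cong2[where f = minus] sum.cong refl if_cong arg_cong[where f = "(dvd) f"]) auto

text \<open>The congruence makes f divide a polynomial of smaller degree, so only the excluded zero
  vector satisfies it.\<close>

lemma R_1_eq_0:
  assumes "g 1 = 1"
  shows "R \<gamma> 1 g f = 0"
proof -
  have "(\<lambda>i\<in>{1..1}. 0) = h"
    if h: "h \<in> {1..1} \<rightarrow>\<^sub>E G (degree f)" and dvd: "f dvd h 1" for h :: "nat \<Rightarrow> 'a mod_ring poly"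
  proof -
    have "h 1 \<in> G (degree f)"
      using h by (simp add: PiE_iff)
    then have "h 1 = 0"
      using dvd dvd_imp_degree_le[OF dvd] by (fastforce simp: G_def)
    then show ?thesis
      using h by (auto simp: fun_eq_iff PiE_iff extensional_def)
  qed
  then have "{h \<in> ({1..1} \<rightarrow>\<^sub>E G (degree f)) - {\<lambda>i\<in>{1..1}. 0}.
      [(\<Sum>i=1..1. h i * g i) = 0] (mod f)} = {}"
    using assms unfolding cong_0_iff by auto
  then show ?thesis
    unfolding R_def by (simp only: sum.empty)
qed

lemma R_Suc_le_of_is_arg_min:
  fixes g :: "nat \<Rightarrow> 'p::prime_card mod_ring poly"
  assumes m: "m > 0" and \<gamma>: "\<And>i. i \<in> {1..Suc d} \<Longrightarrow> \<gamma> i \<ge> 0"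
    and min: "is_arg_min (\<lambda>q. R \<gamma> (Suc d) (shifted w (g(Suc d := q))) (Polynomial.monom 1 m))
      (\<lambda>q. q \<in> G_red m (w (Suc d)) (Polynomial.monom 1 m)) (g (Suc d))"
  defines "C \<equiv> (real CARD('p) ^ 2 - 1) / (3 * real CARD('p))"
  shows "R \<gamma> (Suc d) (shifted w g) (Polynomial.monom 1 m)
    \<le> (1 + \<gamma> (Suc d)) * R \<gamma> d (shifted w g) (Polynomial.monom 1 m)
      + \<gamma> (Suc d) * (2 * real CARD('p) ^ min (w (Suc d)) m * real m * C / real CARD('p) ^ m)
        * (\<Prod>i=1..d. 1 + \<gamma> i + \<gamma> i * (real m * C))"
proof -
  let ?f = "Polynomial.monom 1 m :: 'p mod_ring poly"
  let ?A = "G_red m (w (Suc d)) ?f"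
  let ?P = "{1..d} \<rightarrow>\<^sub>E (G m :: 'p mod_ring poly set)"
  let ?W = "\<lambda>h. \<Prod>i=1..d. r_weighted (h i :: 'p mod_ring poly) (\<gamma> i)"
  let ?R = "\<lambda>q. R \<gamma> (Suc d) (shifted w (g(Suc d := q))) ?f"
  let ?K = "2 * real CARD('p) ^ min (w (Suc d)) m * real m * C / real CARD('p) ^ m"
  let ?S = "\<lambda>h q. \<Sum>k\<in>{k \<in> G m - {0}.
      ?f dvd (\<Sum>i=1..d. h i * shifted w g i) + k * (Polynomial.monom 1 (w (Suc d)) * q)}. r k"
  have "g (Suc d) \<in> ?A" and le: "\<And>q. q \<in> ?A \<Longrightarrow> ?R (g (Suc d)) \<le> ?R q"
    using min by (auto simp: is_arg_min_def not_less)
  then have A: "real (card ?A) > 0"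
    by (auto simp: card_gt_0_iff)
  have deg: "degree ?f = m"
    by (simp add: degree_monom_eq)
  have same: "shifted w (g(Suc d := q)) i = shifted w g i" if "i \<in> {1..d}" for q i
    using that by (simp add: shifted_def)
  have R: "?R q = (1 + \<gamma> (Suc d)) * R \<gamma> d (shifted w g) ?f + \<gamma> (Suc d) * (\<Sum>h\<in>?P. ?W h * ?S h q)" for q
  proof -
    have "R \<gamma> d (shifted w (g(Suc d := q))) ?f = R \<gamma> d (shifted w g) ?f"
      by (rule R_cong) (rule same)
    moreover have "(\<Sum>i=1..d. h i * shifted w (g(Suc d := q)) i) = (\<Sum>i=1..d. h i * shifted w g i)" for h
      by (intro sum.cong refl) (simp only: same)
    moreover have "shifted w (g(Suc d := q)) (Suc d) = Polynomial.monom 1 (w (Suc d)) * q"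
      by (simp add: shifted_def)
    ultimately show ?thesis
      by (simp only: R_Suc deg)
  qed
  have W: "?W h \<ge> 0" for h
    using \<gamma> by (intro prod_nonneg r_weighted_nonneg) auto
  have "(\<Sum>q\<in>?A. \<Sum>h\<in>?P. ?W h * ?S h q) = (\<Sum>h\<in>?P. ?W h * (\<Sum>q\<in>?A. ?S h q))"
    by (subst sum.swap) (simp only: sum_distrib_left)
  \<comment> \<open>For each h, the fixed part of the congruence plays the role of u. The bound does
    not depend on h, so the remaining sum of weights factors over the components.\<close>
  also have "\<dots> \<le> (\<Sum>h\<in>?P. ?W h * (real (card ?A) * ?K))"
    unfolding C_def by (intro sum_mono mult_left_mono W sum_r_solutions_G_red_le m)
  also have "\<dots> = (\<Prod>i=1..d. 1 + \<gamma> i + \<gamma> i * (real m * C)) * (real (card ?A) * ?K)"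
    unfolding sum_distrib_right[symmetric] C_def
    using prod_sum_PiE[of "{1..d}" "\<lambda>_. G m" "\<lambda>i h. r_weighted (h :: 'p mod_ring poly) (\<gamma> i)"]
    by (simp only: sum_r_weighted finite_G finite_atLeastAtMost)
  finally have avg: "(\<Sum>q\<in>?A. \<Sum>h\<in>?P. ?W h * ?S h q)
      \<le> (\<Prod>i=1..d. 1 + \<gamma> i + \<gamma> i * (real m * C)) * (real (card ?A) * ?K)" .
  \<comment> \<open>Minimum at most average, multiplied by the number of candidates to avoid
    division.\<close>
  have "real (card ?A) * ?R (g (Suc d)) \<le> (\<Sum>q\<in>?A. ?R q)"
    using sum_bounded_below[of ?A "?R (g (Suc d))" ?R] le by simp
  also have "\<dots> = real (card ?A) * ((1 + \<gamma> (Suc d)) * R \<gamma> d (shifted w g) ?f)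
      + \<gamma> (Suc d) * (\<Sum>q\<in>?A. \<Sum>h\<in>?P. ?W h * ?S h q)"
    unfolding R by (simp add: sum.distrib sum_distrib_left)
  also have "\<dots> \<le> real (card ?A) * ((1 + \<gamma> (Suc d)) * R \<gamma> d (shifted w g) ?f)
      + \<gamma> (Suc d) * ((\<Prod>i=1..d. 1 + \<gamma> i + \<gamma> i * (real m * C)) * (real (card ?A) * ?K))"
    using avg \<gamma> by (intro add_left_mono mult_left_mono) auto
  also have "\<dots> = real (card ?A) * ((1 + \<gamma> (Suc d)) * R \<gamma> d (shifted w g) ?f
        + \<gamma> (Suc d) * ?K * (\<Prod>i=1..d. 1 + \<gamma> i + \<gamma> i * (real m * C)))"
    by (simp only: distrib_left mult_ac)
  finally have "real (card ?A) * ?R (g (Suc d)) \<le> real (card ?A)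
      * ((1 + \<gamma> (Suc d)) * R \<gamma> d (shifted w g) ?f
        + \<gamma> (Suc d) * ?K * (\<Prod>i=1..d. 1 + \<gamma> i + \<gamma> i * (real m * C)))" .
  then have "?R (g (Suc d)) \<le> (1 + \<gamma> (Suc d)) * R \<gamma> d (shifted w g) ?f
        + \<gamma> (Suc d) * ?K * (\<Prod>i=1..d. 1 + \<gamma> i + \<gamma> i * (real m * C))"
    using A by (simp only: mult_le_cancel_left_pos)
  then show ?thesis
    by simp
qed

theorem theorem1:
  fixes m s d :: nat
    and \<gamma> :: "nat \<Rightarrow> real"
    and w :: "nat \<Rightarrow> nat"
    and g :: "nat \<Rightarrow> 'p::prime_card mod_ring poly"
  assumes "m \<ge> 1" and "s \<ge> 2"
    and "antimono_on {1..} \<gamma>"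
    and "\<And>j. j \<ge> 1 \<Longrightarrow> 0 < \<gamma> j \<and> \<gamma> j \<le> 1"
    and "mono_on {1..} w" and "w 1 = 0"
    and "\<And>j. j \<in> {1..s} \<Longrightarrow> g j \<in> G_red m (w j) (Polynomial.monom 1 m)"
    and "reduced_cbc m (Polynomial.monom 1 m) \<gamma> w s g"
    and "d \<in> {1..s}"
  shows "R \<gamma> d (shifted w g) (Polynomial.monom 1 m)
    \<le> 1 / real CARD('p) ^ m
      * (\<Prod>i=1..d. 1 + \<gamma> i + \<gamma> i * (2 * real CARD('p) ^ min (w i) m * real m
            * ((real CARD('p) ^ 2 - 1) / (3 * real CARD('p)))))"
proof -
  let ?p = "real CARD('p)"
  let ?f = "Polynomial.monom 1 m :: 'p mod_ring poly"
  define C where "C = (?p ^ 2 - 1) / (3 * ?p)"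
  define K where "K i = 2 * ?p ^ min (w i) m * real m * C" for i
  let ?B = "\<lambda>d. \<Prod>i=1..d. 1 + \<gamma> i + \<gamma> i * K i"
  have p: "?p \<ge> 1"
    using card_prime_card_gt_1[where 'p = 'p] by simp
  then have C: "C \<ge> 0"
    by (simp add: C_def)
  have \<gamma>: "\<gamma> i \<ge> 0" if "i \<ge> 1" for i
    using assms(4)[OF that] by simp
  \<comment> \<open>Averaging produces products with m C, while the induction hypothesis has
    \<open>K i\<close>. This inequality enlarges the former so that both share the product
    \<open>?B d\<close>.\<close>
  have K: "real m * C \<le> K i" for i
  proof -
    have "1 * (real m * C) \<le> (2 * ?p ^ min (w i) m) * (real m * C)"
    proof (rule mult_right_mono)
      show "1 \<le> 2 * ?p ^ min (w i) m"
        using one_le_power[OF p, of "min (w i) m"] by linarith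
    qed (use C in simp)
    then show ?thesis
      by (simp add: K_def mult_ac)
  qed
  have K0: "K i \<ge> 0" for i
    using C by (simp add: K_def)
  have "R \<gamma> d (shifted w g) ?f \<le> 1 / ?p ^ m * ?B d" if "1 \<le> d" "d \<le> s" for d
    using that
  proof (induction d rule: dec_induct)
    case base
    have "shifted w g 1 = 1"
      using assms(6,8) by (simp add: shifted_def reduced_cbc_def)
    moreover have "?B 1 \<ge> 0"
      using \<gamma> K0 by simp
    ultimately show ?case
      by (simp only: R_1_eq_0) simp
  next
    case (step d)
    have min: "is_arg_min (\<lambda>q. R \<gamma> (Suc d) (shifted w (g(Suc d := q))) ?f)
        (\<lambda>q. q \<in> G_red m (w (Suc d)) ?f) (g (Suc d))"
      using assms(8) step by (simp add: reduced_cbc_def)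
    have "R \<gamma> (Suc d) (shifted w g) ?f \<le> (1 + \<gamma> (Suc d)) * R \<gamma> d (shifted w g) ?f
        + \<gamma> (Suc d) * (K (Suc d) / ?p ^ m) * (\<Prod>i=1..d. 1 + \<gamma> i + \<gamma> i * (real m * C))"
      using R_Suc_le_of_is_arg_min[OF _ _ min] \<gamma> assms(1) by (simp add: K_def C_def)
    also have "\<dots> \<le> (1 + \<gamma> (Suc d)) * (1 / ?p ^ m * ?B d) + \<gamma> (Suc d) * (K (Suc d) / ?p ^ m) * ?B d"
      using step \<gamma> K K0 C
      by (intro add_mono mult_left_mono prod_mono conjI add_nonneg_nonneg mult_nonneg_nonneg) auto
    \<comment> \<open>The coefficients of \<open>?B d\<close> add up to 1 + \<gamma> (Suc d) +
      \<gamma> (Suc d) * K (Suc d), the next factor of the product.\<close>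
    also have "\<dots> = 1 / ?p ^ m * ?B (Suc d)"
      by (simp add: field_simps)
    finally show ?case .
  qed
  then show ?thesis
    using assms(9) by (simp add: K_def C_def)
qed

end
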